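(* Let $(\Omega,\rightarrow,\triangleright)$ be an EAS and let $(A,\Phi)$ be its linearization, that is to say $A=\mathbb{K}\Omega$ and $\Phi:A\otimes A\longrightarrow A\otimes A$ is the linear map given by $\Phi(\alpha\otimes\beta)=(\alpha\rightarrow\beta)\otimes(\alpha\triangleright\beta)$ for $\alpha,\beta\in\Omega$. The following defines a morphism of nonsymmetric operads: $$\Theta_\Omega:\mathbf{As}_\Omega^2\longrightarrow\mathbf{As}_\Phi,\qquad *_{\alpha,\beta}\longmapsto *_{\alpha\triangleright\beta}.$$
   Context: $\mathbb{K}$ is a field. An extended associative semigroup (EAS) is a nonempty set $\Omega$ with maps $\rightarrow,\triangleright:\Omega^2\to\Omega$ such that for all $\alpha,\beta,\gamma\in\Omega$: $\alpha\rightarrow(\beta\rightarrow\gamma)=(\alpha\rightarrow\beta)\rightarrow\gamma$; $(\alpha\triangleright(\beta\rightarrow\gamma))\rightarrow(\beta\triangleright\gamma)=(\alpha\rightarrow\beta)\triangleright\gamma$; $(\alpha\triangleright(\beta\rightarrow\gamma))\triangleright(\beta\triangleright\gamma)=\alpha\triangleright\beta$. $\mathbf{As}_\Omega^2$ (defined from the semigroup $(\Omega,\rightarrow)$) is the nonsymmetric operad generated by binary operations $*_{\alpha,\beta}$, $(\alpha,\beta)\in\Omega^2$, with relations $*_{\alpha\rightarrow\beta,\gamma}\circ_1 *_{\alpha,\beta}=*_{\alpha,\beta\rightarrow\gamma}\circ_2 *_{\beta,\gamma}$. $\mathbf{As}_\Phi$ is here the nonsymmetric operad of $\Omega$-associative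 algebras, generated by binary operations $*_\alpha$, $\alpha\in\Omega$, with relations $*_\alpha\circ_2 *_\beta=*_{\alpha\rightarrow\beta}\circ_1 *_{\alpha\triangleright\beta}$, i.e. $x*_\alpha(y*_\beta z)=(x*_{\alpha\triangleright\beta}y)*_{\alpha\rightarrow\beta}z$. *)

theory Defs
  imports "HOL-Algebra.Algebraic_Closure_Type" "HOL-Algebra.AbelCoset" "HOL-Library.Poly_Mapping"
begin

section \<open>Nonsymmetric operads over a field\<close>

text \<open>
  A nonsymmetric operad is presented by its partial compositions. Different arities may share
  elements of the underlying type (the zero of a space of finitely supported functions, say), so
  the arities are arguments of the composition: \<open>pcomp P m n i x y\<close> is \<open>x \<circ>\<^sub>i y\<close> for \<open>x\<close> of
  arity \<open>m\<close>, \<open>y\<close> of arity \<open>n\<close> and \<open>1 \<le> i \<le> m\<close>.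
\<close>

record ('k, 'x) ns_operad =
  arity_space :: "nat \<Rightarrow> ('k, 'x) module"
  op_unit :: 'x
  pcomp :: "nat \<Rightarrow> nat \<Rightarrow> nat \<Rightarrow> 'x \<Rightarrow> 'x \<Rightarrow> 'x"

abbreviation op_carrier :: "('k, 'x) ns_operad \<Rightarrow> nat \<Rightarrow> 'x set" where
  "op_carrier P n \<equiv> carrier (arity_space P n)"

locale ns_operad = K?: field K
  for K :: "'k ring" (structure) and P :: "('k, 'x) ns_operad" +
  assumes arity_module: "module K (arity_space P n)"
    and unit_closed: "op_unit P \<in> op_carrier P 1"
    and pcomp_closed:
      "\<lbrakk>x \<in> op_carrier P m; y \<in> op_carrier P n; 1 \<le> i; i \<le> m\<rbrakk>
        \<Longrightarrow> pcomp P m n i x y \<in> op_carrier P (m + n - 1)"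
    and pcomp_add_left:
      "\<lbrakk>x \<in> op_carrier P m; x' \<in> op_carrier P m; y \<in> op_carrier P n; 1 \<le> i; i \<le> m\<rbrakk>
        \<Longrightarrow> pcomp P m n i (x \<oplus>\<^bsub>arity_space P m\<^esub> x') y
          = pcomp P m n i x y \<oplus>\<^bsub>arity_space P (m + n - 1)\<^esub> pcomp P m n i x' y"
    and pcomp_add_right:
      "\<lbrakk>x \<in> op_carrier P m; y \<in> op_carrier P n; y' \<in> op_carrier P n; 1 \<le> i; i \<le> m\<rbrakk>
        \<Longrightarrow> pcomp P m n i x (y \<oplus>\<^bsub>arity_space P n\<^esub> y')
          = pcomp P m n i x y \<oplus>\<^bsub>arity_space P (m + n - 1)\<^esub> pcomp P m n i x y'"
    and pcomp_smult_left:
      "\<lbrakk>c \<in> carrier K; x \<in> op_carrier P m; y \<in> op_carrier P n; 1 \<le> i; i \<le> m\<rbrakk>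
        \<Longrightarrow> pcomp P m n i (c \<odot>\<^bsub>arity_space P m\<^esub> x) y
          = c \<odot>\<^bsub>arity_space P (m + n - 1)\<^esub> pcomp P m n i x y"
    and pcomp_smult_right:
      "\<lbrakk>c \<in> carrier K; x \<in> op_carrier P m; y \<in> op_carrier P n; 1 \<le> i; i \<le> m\<rbrakk>
        \<Longrightarrow> pcomp P m n i x (c \<odot>\<^bsub>arity_space P n\<^esub> y)
          = c \<odot>\<^bsub>arity_space P (m + n - 1)\<^esub> pcomp P m n i x y"
    and unit_left:
      "x \<in> op_carrier P n \<Longrightarrow> pcomp P 1 n 1 (op_unit P) x = x"
    and unit_right:
      "\<lbrakk>x \<in> op_carrier P m; 1 \<le> i; i \<le> m\<rbrakk> \<Longrightarrow> pcomp P m 1 i x (op_unit P) = x"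
    and sequential_assoc:
      "\<lbrakk>x \<in> op_carrier P l; y \<in> op_carrier P m; z \<in> op_carrier P n;
        1 \<le> i; i \<le> l; 1 \<le> j; j \<le> m\<rbrakk>
        \<Longrightarrow> pcomp P (l + m - 1) n (i + j - 1) (pcomp P l m i x y) z
          = pcomp P l (m + n - 1) i x (pcomp P m n j y z)"
    and parallel_assoc:
      "\<lbrakk>x \<in> op_carrier P l; y \<in> op_carrier P m; z \<in> op_carrier P n;
        1 \<le> i; i < j; j \<le> l\<rbrakk>
        \<Longrightarrow> pcomp P (l + m - 1) n (j + m - 1) (pcomp P l m i x y) z
          = pcomp P (l + n - 1) m i (pcomp P l n j x z) y"

locale ns_operad_hom = source: ns_operad K P + target: ns_operad K Q
  for K :: "'k ring" (structure) and P :: "('k, 'x) ns_operad" and Q :: "('k, 'y) ns_operad"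
    and \<Theta> :: "nat \<Rightarrow> 'x \<Rightarrow> 'y" +
  assumes hom_closed: "x \<in> op_carrier P n \<Longrightarrow> \<Theta> n x \<in> op_carrier Q n"
    and hom_add: "\<lbrakk>x \<in> op_carrier P n; y \<in> op_carrier P n\<rbrakk>
      \<Longrightarrow> \<Theta> n (x \<oplus>\<^bsub>arity_space P n\<^esub> y) = \<Theta> n x \<oplus>\<^bsub>arity_space Q n\<^esub> \<Theta> n y"
    and hom_smult: "\<lbrakk>c \<in> carrier K; x \<in> op_carrier P n\<rbrakk>
      \<Longrightarrow> \<Theta> n (c \<odot>\<^bsub>arity_space P n\<^esub> x) = c \<odot>\<^bsub>arity_space Q n\<^esub> \<Theta> n x"
    and hom_unit: "\<Theta> 1 (op_unit P) = op_unit Q"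
    and hom_pcomp: "\<lbrakk>x \<in> op_carrier P m; y \<in> op_carrier P n; 1 \<le> i; i \<le> m\<rbrakk>
      \<Longrightarrow> \<Theta> (m + n - 1) (pcomp P m n i x y) = pcomp Q m n i (\<Theta> m x) (\<Theta> n y)"


section \<open>Operadic ideals and quotients\<close>

locale operadic_ideal =
  fixes K :: "'k ring" and P :: "('k, 'x) ns_operad" and I :: "nat \<Rightarrow> 'x set"
  assumes ideal_submodule: "submodule (I n) K (arity_space P n)"
    and ideal_left: "\<lbrakk>x \<in> I m; y \<in> op_carrier P n; 1 \<le> i; i \<le> m\<rbrakk>
      \<Longrightarrow> pcomp P m n i x y \<in> I (m + n - 1)"
    and ideal_right: "\<lbrakk>x \<in> op_carrier P m; y \<in> I n; 1 \<le> i; i \<le> m\<rbrakk>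
      \<Longrightarrow> pcomp P m n i x y \<in> I (m + n - 1)"

definition generated_ideal ::
  "'k ring \<Rightarrow> ('k, 'x) ns_operad \<Rightarrow> (nat \<Rightarrow> 'x set) \<Rightarrow> nat \<Rightarrow> 'x set" where
  "generated_ideal K P R n =
     \<Inter> {I n | I. operadic_ideal K P I \<and> (\<forall>m. R m \<subseteq> I m)}"

text \<open>
  The operations on cosets follow the pattern of \<^const>\<open>rcoset_mult\<close>. The ring
  multiplication and one of the \<open>module\<close> record play no role.
\<close>

definition quotient_space :: "('k, 'x) module \<Rightarrow> 'x set \<Rightarrow> ('k, 'x set) module" where
  "quotient_space M N =
     \<lparr>carrier = a_rcosets\<^bsub>M\<^esub> N, monoid.mult = undefined, one = undefined,
      zero = N, add = set_add M,
      module.smult = (\<lambda>c U. \<Union>x\<in>U. N +>\<^bsub>M\<^esub> (c \<odot>\<^bsub>M\<^esub> x))\<rparr>"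

definition quotient_operad ::
  "('k, 'x) ns_operad \<Rightarrow> (nat \<Rightarrow> 'x set) \<Rightarrow> ('k, 'x set) ns_operad" where
  "quotient_operad P I =
     \<lparr>arity_space = (\<lambda>n. quotient_space (arity_space P n) (I n)),
      op_unit = I 1 +>\<^bsub>arity_space P 1\<^esub> op_unit P,
      pcomp = (\<lambda>m n i U V. \<Union>x\<in>U. \<Union>y\<in>V.
        I (m + n - 1) +>\<^bsub>arity_space P (m + n - 1)\<^esub> pcomp P m n i x y)\<rparr>"


section \<open>The free nonsymmetric operad on binary generators\<close>

text \<open>
  In arity \<open>n\<close>, the free operad on a set of binary generators has as basis the planar binary
  trees with \<open>n\<close> leaves whose internal vertices are decorated by generators. The partial
  composition \<open>s \<circ>\<^sub>i t\<close> of two trees grafts the root of \<open>t\<close> on the \<open>i\<close>-th leaf of \<open>s\<close>, the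
  leaves being numbered from left to right, starting from 1.
\<close>

datatype 'g bintree = Leaf | Node 'g "'g bintree" "'g bintree"

fun leaves :: "'g bintree \<Rightarrow> nat" where
  "leaves Leaf = 1"
| "leaves (Node g l r) = leaves l + leaves r"

fun graft :: "'g bintree \<Rightarrow> nat \<Rightarrow> 'g bintree \<Rightarrow> 'g bintree" where
  "graft Leaf i t = t"
| "graft (Node g l r) i t =
    (if i \<le> leaves l then Node g (graft l i t) r else Node g l (graft r (i - leaves l) t))"

text \<open>
  \<^typ>\<open>'b \<Rightarrow>\<^sub>0 'k\<close> is the \<open>'k\<close>-vector space with basis \<open>'b\<close>.
\<close>

definition scale :: "'k::field \<Rightarrow> ('b \<Rightarrow>\<^sub>0 'k) \<Rightarrow> ('b \<Rightarrow>\<^sub>0 'k)" where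
  "scale c v = Poly_Mapping.map (\<lambda>a. c * a) v"

definition free_space :: "nat \<Rightarrow> ('k::field, 'g bintree \<Rightarrow>\<^sub>0 'k) module" where
  "free_space n =
     \<lparr>carrier = {v. \<forall>t \<in> Poly_Mapping.keys v. leaves t = n}, monoid.mult = undefined, one = undefined,
      zero = 0, add = (+), module.smult = scale\<rparr>"

definition free_pcomp ::
  "nat \<Rightarrow> ('g bintree \<Rightarrow>\<^sub>0 'k::field) \<Rightarrow> ('g bintree \<Rightarrow>\<^sub>0 'k) \<Rightarrow> ('g bintree \<Rightarrow>\<^sub>0 'k)" where
  "free_pcomp i v w =
     (\<Sum>s \<in> Poly_Mapping.keys v. \<Sum>t \<in> Poly_Mapping.keys w.
        Poly_Mapping.single (graft s i t) (Poly_Mapping.lookup v s * Poly_Mapping.lookup w t))"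

definition free_operad :: "('k::field, 'g bintree \<Rightarrow>\<^sub>0 'k) ns_operad" where
  "free_operad =
     \<lparr>arity_space = free_space,
      op_unit = Poly_Mapping.single Leaf 1,
      pcomp = (\<lambda>m n i. free_pcomp i)\<rparr>"

definition free_gen :: "'g \<Rightarrow> 'g bintree \<Rightarrow>\<^sub>0 'k::field" where
  "free_gen g = Poly_Mapping.single (Node g Leaf Leaf) 1"

text \<open>
  The operad generated by binary operations indexed by \<open>'g\<close>, with (quadratic) relations
  \<open>r = 0\<close> for \<open>r \<in> R\<close>, where \<open>R\<close> is a set of elements of arity 3.
\<close>

definition relation_ideal ::
  "('g bintree \<Rightarrow>\<^sub>0 'k::field) set \<Rightarrow> nat \<Rightarrow> ('g bintree \<Rightarrow>\<^sub>0 'k) set" where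
  "relation_ideal R =
     generated_ideal ring_of_type_algebra free_operad (\<lambda>n. if n = 3 then R else {})"

definition presented_operad ::
  "('g bintree \<Rightarrow>\<^sub>0 'k::field) set \<Rightarrow> ('k, ('g bintree \<Rightarrow>\<^sub>0 'k) set) ns_operad" where
  "presented_operad R = quotient_operad free_operad (relation_ideal R)"

definition presented_gen ::
  "('g bintree \<Rightarrow>\<^sub>0 'k::field) set \<Rightarrow> 'g \<Rightarrow> ('g bintree \<Rightarrow>\<^sub>0 'k) set" where
  "presented_gen R g = relation_ideal R 2 +>\<^bsub>arity_space free_operad 2\<^esub> free_gen g"


section \<open>Extended associative semigroups and their linearization\<close>

text \<open>
  The (nonempty) set \<open>\<Omega>\<close> is the type \<open>'w\<close>; \<open>arr\<close> and \<open>tri\<close> are \<open>\<rightarrow>\<close> and \<open>\<triangleright>\<close>.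
\<close>

locale EAS =
  fixes arr :: "'w \<Rightarrow> 'w \<Rightarrow> 'w" and tri :: "'w \<Rightarrow> 'w \<Rightarrow> 'w"
  assumes arr_assoc: "arr \<alpha> (arr \<beta> \<gamma>) = arr (arr \<alpha> \<beta>) \<gamma>"
    and arr_tri: "arr (tri \<alpha> (arr \<beta> \<gamma>)) (tri \<beta> \<gamma>) = tri (arr \<alpha> \<beta>) \<gamma>"
    and tri_tri: "tri (tri \<alpha> (arr \<beta> \<gamma>)) (tri \<beta> \<gamma>) = tri \<alpha> \<beta>"

text \<open>
  For \<open>A = \<bbbK>\<Omega>\<close>, the space \<open>A \<otimes> A\<close> has basis \<open>\<Omega> \<times> \<Omega>\<close> and is realised as
  \<^typ>\<open>('w \<times> 'w) \<Rightarrow>\<^sub>0 'k\<close>, the tensor \<open>\<alpha> \<otimes> \<beta>\<close> being the basis vector at \<open>(\<alpha>, \<beta>)\<close>.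
  The map \<open>\<Phi>\<close> is the linear extension of \<open>\<alpha> \<otimes> \<beta> \<mapsto> (\<alpha> \<rightarrow> \<beta>) \<otimes> (\<alpha> \<triangleright> \<beta>)\<close>.
\<close>

abbreviation tensor :: "'w \<Rightarrow> 'w \<Rightarrow> ('w \<times> 'w) \<Rightarrow>\<^sub>0 'k::field" where
  "tensor \<alpha> \<beta> \<equiv> Poly_Mapping.single (\<alpha>, \<beta>) 1"

definition linearization ::
  "('w \<Rightarrow> 'w \<Rightarrow> 'w) \<Rightarrow> ('w \<Rightarrow> 'w \<Rightarrow> 'w)
    \<Rightarrow> (('w \<times> 'w) \<Rightarrow>\<^sub>0 'k::field) \<Rightarrow> (('w \<times> 'w) \<Rightarrow>\<^sub>0 'k)" where
  "linearization arr tri v =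
     (\<Sum>(\<alpha>, \<beta>) \<in> Poly_Mapping.keys v.
        scale (Poly_Mapping.lookup v (\<alpha>, \<beta>)) (tensor (arr \<alpha> \<beta>) (tri \<alpha> \<beta>)))"

lemma lookup_scale [simp]: "Poly_Mapping.lookup (scale c v) b = c * Poly_Mapping.lookup v b"
  by (simp add: scale_def Poly_Mapping.map.rep_eq when_def)

lemma scale_one [simp]: "scale 1 v = v"
  by (rule poly_mapping_eqI) simp

lemma linearization_tensor [simp]:
  "linearization arr tri (tensor \<alpha> \<beta>) = tensor (arr \<alpha> \<beta>) (tri \<alpha> \<beta>)"
  by (simp add: linearization_def)

lemma linearization_sum:
  assumes "finite S" "Poly_Mapping.keys v \<subseteq> S"
  shows "linearization arr tri v =
    (\<Sum>(\<alpha>, \<beta>) \<in> S.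
      scale (Poly_Mapping.lookup v (\<alpha>, \<beta>)) (tensor (arr \<alpha> \<beta>) (tri \<alpha> \<beta>)))"
  unfolding linearization_def
  by (rule sum.mono_neutral_left)
    (use assms in \<open>auto simp: in_keys_iff intro!: poly_mapping_eqI\<close>)

lemma linearization_add:
  "linearization arr tri (v + w) = linearization arr tri v + linearization arr tri w"
proof -
  let ?S = "Poly_Mapping.keys v \<union> Poly_Mapping.keys w"
  have dist: "scale (a + b) u = scale a u + scale b u" for a b :: 'b and u :: "'c \<Rightarrow>\<^sub>0 'b"
    by (rule poly_mapping_eqI) (simp add: lookup_add distrib_right)
  show ?thesis
    by (subst (1 2 3) linearization_sum[of ?S])
      (auto simp: Poly_Mapping.keys_add lookup_add dist case_prod_unfold sum.distrib)
qed

lemma linearization_scale: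
  "linearization arr tri (scale c v) = scale c (linearization arr tri v)"
proof -
  have "Poly_Mapping.keys (scale c v) \<subseteq> Poly_Mapping.keys v"
    by (auto simp: in_keys_iff)
  then show ?thesis
    by (subst (1 2) linearization_sum[of "Poly_Mapping.keys v"])
      (auto intro!: poly_mapping_eqI simp: lookup_sum case_prod_unfold sum_distrib_left mult.assoc)
qed


section \<open>The operads \<open>As\<^sup>2\<^sub>\<Omega>\<close> and \<open>As\<^sub>\<Phi>\<close>\<close>

definition As2_relations ::
  "('w \<Rightarrow> 'w \<Rightarrow> 'w) \<Rightarrow> (('w \<times> 'w) bintree \<Rightarrow>\<^sub>0 'k::field) set" where
  "As2_relations arr =
     {free_pcomp 1 (free_gen (arr \<alpha> \<beta>, \<gamma>)) (free_gen (\<alpha>, \<beta>))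
      - free_pcomp 2 (free_gen (\<alpha>, arr \<beta> \<gamma>)) (free_gen (\<beta>, \<gamma>)) | \<alpha> \<beta> \<gamma>. True}"

definition As2 ::
  "('w \<Rightarrow> 'w \<Rightarrow> 'w) \<Rightarrow> ('k::field, (('w \<times> 'w) bintree \<Rightarrow>\<^sub>0 'k) set) ns_operad" where
  "As2 arr = presented_operad (As2_relations arr)"

definition As2_gen ::
  "('w \<Rightarrow> 'w \<Rightarrow> 'w) \<Rightarrow> 'w \<Rightarrow> 'w \<Rightarrow> (('w \<times> 'w) bintree \<Rightarrow>\<^sub>0 'k::field) set" where
  "As2_gen arr \<alpha> \<beta> = presented_gen (As2_relations arr) (\<alpha>, \<beta>)"

text \<open>
  For a linear map \<open>\<Phi>\<close> on \<open>\<bbbK>\<Omega> \<otimes> \<bbbK>\<Omega>\<close>, the relations of \<open>As\<^sub>\<Phi>\<close> are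
  \<open>*\<^sub>\<alpha> \<circ>\<^sub>2 *\<^sub>\<beta> = \<Sum> c\<^sub>\<gamma>\<^sub>\<delta> *\<^sub>\<gamma> \<circ>\<^sub>1 *\<^sub>\<delta>\<close>, where \<open>\<Phi>(\<alpha> \<otimes> \<beta>) = \<Sum> c\<^sub>\<gamma>\<^sub>\<delta> \<gamma> \<otimes> \<delta>\<close>. The lemma
  \<open>AsPhi_relations_linearization\<close> makes them explicit for the linearization of
  \<open>(\<Omega>, \<rightarrow>, \<triangleright>)\<close>.
\<close>

definition AsPhi_relations ::
  "((('w \<times> 'w) \<Rightarrow>\<^sub>0 'k::field) \<Rightarrow> (('w \<times> 'w) \<Rightarrow>\<^sub>0 'k)) \<Rightarrow> ('w bintree \<Rightarrow>\<^sub>0 'k) set" where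
  "AsPhi_relations \<Phi> =
     {free_pcomp 2 (free_gen \<alpha>) (free_gen \<beta>)
      - (\<Sum>(\<gamma>, \<delta>) \<in> Poly_Mapping.keys (\<Phi> (tensor \<alpha> \<beta>)).
           scale (Poly_Mapping.lookup (\<Phi> (tensor \<alpha> \<beta>)) (\<gamma>, \<delta>))
             (free_pcomp 1 (free_gen \<gamma>) (free_gen \<delta>))) | \<alpha> \<beta>. True}"

lemma AsPhi_relations_linearization:
  "AsPhi_relations (linearization arr tri) =
     {free_pcomp 2 (free_gen \<alpha>) (free_gen \<beta>)
      - free_pcomp 1 (free_gen (arr \<alpha> \<beta>)) (free_gen (tri \<alpha> \<beta>)) | \<alpha> \<beta>. True}"
  by (simp add: AsPhi_relations_def)

definition AsPhi ::
  "((('w \<times> 'w) \<Rightarrow>\<^sub>0 'k::field) \<Rightarrow> (('w \<times> 'w) \<Rightarrow>\<^sub>0 'k))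
    \<Rightarrow> ('k, ('w bintree \<Rightarrow>\<^sub>0 'k) set) ns_operad" where
  "AsPhi \<Phi> = presented_operad (AsPhi_relations \<Phi>)"

definition AsPhi_gen ::
  "((('w \<times> 'w) \<Rightarrow>\<^sub>0 'k::field) \<Rightarrow> (('w \<times> 'w) \<Rightarrow>\<^sub>0 'k)) \<Rightarrow> 'w \<Rightarrow> ('w bintree \<Rightarrow>\<^sub>0 'k) set" where
  "AsPhi_gen \<Phi> \<alpha> = presented_gen (AsPhi_relations \<Phi>) \<alpha>"

end

theory Submission
  imports Defs
begin

text \<open>
  A map of generators induces a morphism of free operads by relabelling the internal vertices of
  trees, and it descends to the presented operads as soon as it sends relations to relations.
  Under \<open>(\<alpha>, \<beta>) \<mapsto> \<alpha> \<triangleright> \<beta>\<close>, the relation of \<open>As\<^sup>2\<^sub>\<Omega>\<close> at \<open>(\<alpha>, \<beta>, \<gamma>)\<close> becomes, by the last two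
  axioms of an EAS, the opposite of the relation of \<open>As\<^sub>\<Phi>\<close> at \<open>(\<alpha> \<triangleright> (\<beta> \<rightarrow> \<gamma>), \<beta> \<triangleright> \<gamma>)\<close>. Uniqueness
  holds because every tree is an iterated composition of generators.
\<close>

declare One_nat_def [simp del]

section \<open>Quotient operads\<close>

lemma quotient_space_simps [simp]:
  "carrier (quotient_space M N) = a_rcosets\<^bsub>M\<^esub> N"
  "zero (quotient_space M N) = N"
  "add (quotient_space M N) = set_add M"
  by (simp_all add: quotient_space_def)

lemma quotient_operad_simps [simp]:
  "arity_space (quotient_operad P I) n = quotient_space (arity_space P n) (I n)"
  "op_unit (quotient_operad P I) = I 1 +>\<^bsub>arity_space P 1\<^esub> op_unit P"
  by (simp_all add: quotient_operad_def)

text \<open>Operations on cosets are unions over all representatives. Once the value does not depend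
  on the representative, the union collapses to that value; \<open>a\<close> guarantees that there
  is a representative.\<close>

lemma UN_eq_const:
  assumes "a \<in> A" and "\<And>x. x \<in> A \<Longrightarrow> f x = c"
  shows "(\<Union>x\<in>A. f x) = c"
  using assms by auto

section \<open>The quotient of a module by a submodule\<close>

locale module_submodule = module R M + submodule N R M
  for R :: "'a ring" (structure) and M :: "('a, 'b) module" (structure) and N
begin

text \<open>The additive group of a module is commutative, so \<open>N\<close> is normal in it and
  the theory of additive cosets applies.\<close>

sublocale abelian_subgroup N M
  by (intro abelian_subgroupI3 additive_subgroupI subgroup_axioms M.abelian_group_axioms)

text \<open>Well-definedness on cosets is always checked in this form: by \<open>coset_memE\<close>,
  any other representative of the coset of \<open>x\<close> is \<open>x\<close> with an element of
  \<open>N\<close> added on the left.\<close>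

lemma coset_absorb:
  assumes "h \<in> N" "x \<in> carrier M"
  shows "N +>\<^bsub>M\<^esub> (h \<oplus>\<^bsub>M\<^esub> x) = N +>\<^bsub>M\<^esub> x"
  using assms a_rcosI a_repr_independence' a_subset by metis

lemma coset_memE:
  assumes "x' \<in> N +>\<^bsub>M\<^esub> x"
  obtains h where "h \<in> N" "x' = h \<oplus>\<^bsub>M\<^esub> x"
  using assms by (auto simp: a_r_coset_def')

lemma rcosetsE:
  assumes "U \<in> a_rcosets\<^bsub>M\<^esub> N"
  obtains x where "x \<in> carrier M" "U = N +>\<^bsub>M\<^esub> x"
  using assms by (auto simp: A_RCOSETS_def')

lemma coset_in_rcosets: "x \<in> carrier M \<Longrightarrow> N +>\<^bsub>M\<^esub> x \<in> a_rcosets\<^bsub>M\<^esub> N"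
  using a_rcosetsI a_subset by blast

text \<open>Changing \<open>x\<close> by \<open>h\<close> in \<open>N\<close> changes its multiple
  by \<open>c\<close> times \<open>h\<close>, which is again in \<open>N\<close>; so all
  representatives contribute the same coset.\<close>

lemma quotient_smult:
  assumes "c \<in> carrier R" "x \<in> carrier M"
  shows "c \<odot>\<^bsub>quotient_space M N\<^esub> (N +>\<^bsub>M\<^esub> x) = N +>\<^bsub>M\<^esub> (c \<odot>\<^bsub>M\<^esub> x)"
proof -
  have "N +>\<^bsub>M\<^esub> (c \<odot>\<^bsub>M\<^esub> x') = N +>\<^bsub>M\<^esub> (c \<odot>\<^bsub>M\<^esub> x)" if "x' \<in> N +>\<^bsub>M\<^esub> x" for x'
    using that
  proof (rule coset_memE)
    fix h assume "h \<in> N" "x' = h \<oplus>\<^bsub>M\<^esub> x"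
    moreover from this have "c \<odot>\<^bsub>M\<^esub> h \<in> N" "h \<in> carrier M"
      using assms a_subset submodule.smult_closed[OF submodule_axioms] by auto
    ultimately show ?thesis
      using assms by (simp add: smult_r_distr coset_absorb module.smult_closed[OF module_axioms])
  qed
  then have "(\<Union>x'\<in>N +>\<^bsub>M\<^esub> x. N +>\<^bsub>M\<^esub> (c \<odot>\<^bsub>M\<^esub> x')) = N +>\<^bsub>M\<^esub> (c \<odot>\<^bsub>M\<^esub> x)"
    by (intro UN_eq_const[OF a_rcos_self[OF assms(2)]])
  then show ?thesis
    by (simp add: quotient_space_def)
qed

text \<open>Each axiom is inherited from \<open>M\<close>, because sums and multiples of cosets are
  computed on representatives.\<close>

lemma quotient_module: "module R (quotient_space M N)"
proof (rule moduleI)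
  show "abelian_group (quotient_space M N)"
  proof (rule abelian_groupI)
    fix U assume "U \<in> carrier (quotient_space M N)"
    then obtain x where x: "x \<in> carrier M" "U = N +>\<^bsub>M\<^esub> x"
      using rcosetsE by auto
    then show "\<zero>\<^bsub>quotient_space M N\<^esub> \<oplus>\<^bsub>quotient_space M N\<^esub> U = U"
      by (simp add: coset_in_rcosets rcosets_add_eq)
    show "\<exists>V\<in>carrier (quotient_space M N). V \<oplus>\<^bsub>quotient_space M N\<^esub> U = \<zero>\<^bsub>quotient_space M N\<^esub>"
      using x by (intro bexI[of _ "N +>\<^bsub>M\<^esub> (\<ominus>\<^bsub>M\<^esub> x)"])
        (simp_all add: coset_in_rcosets a_rcos_sum M.l_neg a_subset)
  qed (auto elim!: rcosetsE intro!: coset_in_rcosets a_subgroup_in_rcosets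
      simp: a_rcos_sum M.a_ac)
qed (auto elim!: rcosetsE intro!: coset_in_rcosets is_cring
      simp: quotient_smult a_rcos_sum smult_l_distr smult_r_distr smult_assoc1
        module.smult_closed[OF module_axioms])

end

section \<open>The quotient of an operad by an ideal\<close>

locale ns_operad_with_ideal = ns_operad K P + operadic_ideal K P I
  for K (structure) and P I
begin

abbreviation coset where "coset n x \<equiv> I n +>\<^bsub>arity_space P n\<^esub> x"

sublocale M: module_submodule K "arity_space P n" "I n" for n
  by (intro module_submodule.intro arity_module ideal_submodule)

lemma quotient_pcomp:
  assumes "x \<in> op_carrier P m" "y \<in> op_carrier P n" "1 \<le> i" "i \<le> m"
  shows "pcomp (quotient_operad P I) m n i (coset m x) (coset n y)
    = coset (m + n - 1) (pcomp P m n i x y)"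
proof -
  have "coset (m + n - 1) (pcomp P m n i x' y') = coset (m + n - 1) (pcomp P m n i x y)"
    if x': "x' \<in> coset m x" and y': "y' \<in> coset n y" for x' y'
  proof -
    obtain h k where h: "h \<in> I m" "x' = h \<oplus>\<^bsub>arity_space P m\<^esub> x"
      and k: "k \<in> I n" "y' = k \<oplus>\<^bsub>arity_space P n\<^esub> y"
      using x' y' M.coset_memE by metis
    have hk: "h \<in> op_carrier P m" "k \<in> op_carrier P n"
      using h k M.a_subset by blast+
    \<comment> \<open>Biadditivity splits off two error terms: \<open>h\<close> composed with all of
      \<open>y'\<close>, which is in the ideal by \<open>ideal_left\<close>, and \<open>x\<close>
      composed with \<open>k\<close>, which is in it by \<open>ideal_right\<close>. Both are then
      absorbed by the coset.\<close>
    have "pcomp P m n i x' y' = pcomp P m n i h y' \<oplus>\<^bsub>arity_space P (m + n - 1)\<^esub>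
        (pcomp P m n i x k \<oplus>\<^bsub>arity_space P (m + n - 1)\<^esub> pcomp P m n i x y)"
      using h(2) k(2) hk assms pcomp_add_left[of h m x y' n i] pcomp_add_right[of x m k n y i]
        M.M.a_closed[of k n y] by simp
    then show ?thesis
      using h k hk assms ideal_left[of h m y' n i] ideal_right[of x m k n i] pcomp_closed
      by (simp add: M.coset_absorb)
  qed
  then have "(\<Union>x'\<in>coset m x. \<Union>y'\<in>coset n y. coset (m + n - 1) (pcomp P m n i x' y'))
    = coset (m + n - 1) (pcomp P m n i x y)"
    using assms by (intro UN_eq_const[OF M.a_rcos_self] UN_eq_const[OF M.a_rcos_self]) auto
  then show ?thesis
    by (simp add: quotient_operad_def)
qed

text \<open>With representatives chosen for all cosets, \<open>quotient_pcomp\<close> turns every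
  axiom into the same axiom of \<open>P\<close>.\<close>

lemma quotient_ns_operad: "ns_operad K (quotient_operad P I)"
proof (intro ns_operad.intro ns_operad_axioms.intro)
  show "field K" ..
  fix l m n i j and U U' V V' W c
  show "module K (arity_space (quotient_operad P I) n)"
    by (simp add: M.quotient_module)
  show "op_unit (quotient_operad P I) \<in> op_carrier (quotient_operad P I) 1"
    using M.coset_in_rcosets unit_closed by simp
  {
    assume U: "U \<in> op_carrier (quotient_operad P I) n"
    then obtain x where x: "x \<in> op_carrier P n" "U = coset n x"
      using M.rcosetsE by auto
    then show "pcomp (quotient_operad P I) 1 n 1 (op_unit (quotient_operad P I)) U = U"
      using quotient_pcomp[of "op_unit P" 1 x n 1] by (simp add: unit_left unit_closed)
  }
  {
    assume U: "U \<in> op_carrier (quotient_operad P I) m" and i: "1 \<le> i" "i \<le> m"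
    from U obtain x where x: "x \<in> op_carrier P m" "U = coset m x"
      using M.rcosetsE by auto
    then show "pcomp (quotient_operad P I) m 1 i U (op_unit (quotient_operad P I)) = U"
      using i quotient_pcomp[of x m "op_unit P" 1 i] by (simp add: unit_right unit_closed)
  }
  {
    assume U: "U \<in> op_carrier (quotient_operad P I) m" and V: "V \<in> op_carrier (quotient_operad P I) n"
      and i: "1 \<le> i" "i \<le> m"
    obtain x y where x: "x \<in> op_carrier P m" "U = coset m x" and y: "y \<in> op_carrier P n" "V = coset n y"
      using U V by (auto elim!: M.rcosetsE)
    show "pcomp (quotient_operad P I) m n i U V \<in> op_carrier (quotient_operad P I) (m + n - 1)"
      using x y i by (simp add: quotient_pcomp pcomp_closed M.coset_in_rcosets)
    {
      assume "c \<in> carrier K"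
      then show "pcomp (quotient_operad P I) m n i (c \<odot>\<^bsub>arity_space (quotient_operad P I) m\<^esub> U) V
          = c \<odot>\<^bsub>arity_space (quotient_operad P I) (m + n - 1)\<^esub> pcomp (quotient_operad P I) m n i U V"
        "pcomp (quotient_operad P I) m n i U (c \<odot>\<^bsub>arity_space (quotient_operad P I) n\<^esub> V)
          = c \<odot>\<^bsub>arity_space (quotient_operad P I) (m + n - 1)\<^esub> pcomp (quotient_operad P I) m n i U V"
        using x y i module.smult_closed[OF arity_module]
        by (simp_all add: quotient_pcomp pcomp_closed M.quotient_smult pcomp_smult_left pcomp_smult_right)
    }
    {
      assume "U' \<in> op_carrier (quotient_operad P I) m"
      then obtain x' where x': "x' \<in> op_carrier P m" "U' = coset m x'"
        using M.rcosetsE by auto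
      then show "pcomp (quotient_operad P I) m n i (U \<oplus>\<^bsub>arity_space (quotient_operad P I) m\<^esub> U') V
          = pcomp (quotient_operad P I) m n i U V \<oplus>\<^bsub>arity_space (quotient_operad P I) (m + n - 1)\<^esub>
            pcomp (quotient_operad P I) m n i U' V"
        using x y i by (simp add: quotient_pcomp pcomp_closed M.a_rcos_sum pcomp_add_left)
    }
    {
      assume "V' \<in> op_carrier (quotient_operad P I) n"
      then obtain y' where y': "y' \<in> op_carrier P n" "V' = coset n y'"
        using M.rcosetsE by auto
      then show "pcomp (quotient_operad P I) m n i U (V \<oplus>\<^bsub>arity_space (quotient_operad P I) n\<^esub> V')
          = pcomp (quotient_operad P I) m n i U V \<oplus>\<^bsub>arity_space (quotient_operad P I) (m + n - 1)\<^esub>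
            pcomp (quotient_operad P I) m n i U V'"
        using x y i by (simp add: quotient_pcomp pcomp_closed M.a_rcos_sum pcomp_add_right)
    }
  }
  {
    assume "U \<in> op_carrier (quotient_operad P I) l" "V \<in> op_carrier (quotient_operad P I) m"
      "W \<in> op_carrier (quotient_operad P I) n"
    then obtain x y z where xyz: "x \<in> op_carrier P l" "U = coset l x" "y \<in> op_carrier P m" "V = coset m y"
      "z \<in> op_carrier P n" "W = coset n z"
      by (auto elim!: M.rcosetsE)
    {
      assume i: "1 \<le> i" "i \<le> l" "1 \<le> j" "j \<le> m"
      \<comment> \<open>The two sides are formed in arities that are written differently. They agree
        under truncated subtraction because the bounds on \<open>i\<close> and \<open>j\<close> make
        \<open>l\<close> and \<open>m\<close> positive.\<close>
      have "l + m - 1 + n - 1 = l + (m + n - 1) - 1" "i + j - 1 \<le> l + m - 1"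
        using i by auto
      with i xyz show "pcomp (quotient_operad P I) (l + m - 1) n (i + j - 1)
          (pcomp (quotient_operad P I) l m i U V) W
        = pcomp (quotient_operad P I) l (m + n - 1) i U (pcomp (quotient_operad P I) m n j V W)"
        by (simp add: quotient_pcomp pcomp_closed sequential_assoc)
    }
    {
      assume i: "1 \<le> i" "i < j" "j \<le> l"
      \<comment> \<open>Here \<open>1 \<le> i < j \<le> l\<close> gives \<open>2 \<le> j\<close> and
        \<open>2 \<le> l\<close>, so arities and positions stay in range even if \<open>m\<close> or
        \<open>n\<close> is 0.\<close>
      have "l + m - 1 + n - 1 = l + n - 1 + m - 1" "i \<le> l" "1 \<le> j + m - 1" "j + m - 1 \<le> l + m - 1"
         "1 \<le> j" "i \<le> l + n - 1"
        using i by auto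
      with i xyz show "pcomp (quotient_operad P I) (l + m - 1) n (j + m - 1)
          (pcomp (quotient_operad P I) l m i U V) W
        = pcomp (quotient_operad P I) (l + n - 1) m i (pcomp (quotient_operad P I) l n j U W) V"
        by (simp add: quotient_pcomp pcomp_closed parallel_assoc)
    }
  }
qed

end

section \<open>Morphisms and ideals\<close>

text \<open>The projection onto the quotient allows morphisms out of a presented operad to be pulled
  back to the free operad.\<close>

lemma (in ns_operad_with_ideal) coset_hom:
  "ns_operad_hom K P (quotient_operad P I) coset"
proof -
  interpret Q: ns_operad K "quotient_operad P I"
    by (rule quotient_ns_operad)
  show ?thesis
    by unfold_locales
      (simp_all add: quotient_pcomp M.coset_in_rcosets M.a_rcos_sum M.quotient_smult)
qed

lemma ns_operad_hom_comp:
  assumes "ns_operad_hom K P Q F" "ns_operad_hom K Q S G"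
  shows "ns_operad_hom K P S (\<lambda>n x. G n (F n x))"
proof -
  interpret F: ns_operad_hom K P Q F by fact
  interpret G: ns_operad_hom K Q S G by fact
  show ?thesis
    by unfold_locales
      (simp_all add: F.hom_closed F.hom_add F.hom_smult F.hom_unit F.hom_pcomp
        G.hom_closed G.hom_add G.hom_smult G.hom_unit G.hom_pcomp)
qed

context ns_operad_hom
begin

sublocale sp: module K "arity_space P n" for n
  by (rule source.arity_module)

sublocale tq: module K "arity_space Q n" for n
  by (rule target.arity_module)

text \<open>The axioms of a morphism speak of sums and scalar multiples only, so zero is reached as
  a multiple by the scalar zero, and negatives in \<open>hom_neg\<close> as multiples by minus
  one.\<close>

lemma hom_zero: "\<Theta> n \<zero>\<^bsub>arity_space P n\<^esub> = \<zero>\<^bsub>arity_space Q n\<^esub>"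
proof -
  have "\<Theta> n (\<zero> \<odot>\<^bsub>arity_space P n\<^esub> \<zero>\<^bsub>arity_space P n\<^esub>)
    = \<zero> \<odot>\<^bsub>arity_space Q n\<^esub> \<Theta> n \<zero>\<^bsub>arity_space P n\<^esub>"
    by (rule hom_smult) simp_all
  then show ?thesis
    by (simp add: hom_closed)
qed

lemma hom_neg:
  assumes "x \<in> op_carrier P n"
  shows "\<Theta> n (\<ominus>\<^bsub>arity_space P n\<^esub> x) = \<ominus>\<^bsub>arity_space Q n\<^esub> \<Theta> n x"
proof -
  have "\<Theta> n ((\<ominus> \<one>) \<odot>\<^bsub>arity_space P n\<^esub> x) = (\<ominus> \<one>) \<odot>\<^bsub>arity_space Q n\<^esub> \<Theta> n x"
    using assms by (intro hom_smult) simp_all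
  then show ?thesis
    using assms by (simp add: sp.smult_l_minus tq.smult_l_minus hom_closed)
qed

text \<open>Combined with \<open>generated_ideal_least\<close>, this reduces the inclusion of a
  generated ideal in a preimage to its generators.\<close>

lemma vimage_ideal:
  assumes "operadic_ideal K Q J"
  shows "operadic_ideal K P (\<lambda>n. {x \<in> op_carrier P n. \<Theta> n x \<in> J n})"
proof -
  interpret J: operadic_ideal K Q J by fact
  have sub: "submodule {x \<in> op_carrier P n. \<Theta> n x \<in> J n} K (arity_space P n)" for n
  proof (rule sp.submoduleI)
    have "\<zero>\<^bsub>arity_space Q n\<^esub> \<in> J n"
      using subgroup.one_closed[OF submodule.axioms(1)[OF J.ideal_submodule[of n]]] by simp
    then show "\<zero>\<^bsub>arity_space P n\<^esub> \<in> {x \<in> op_carrier P n. \<Theta> n x \<in> J n}"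
      by (simp add: hom_zero)
  qed (auto simp: hom_neg hom_add hom_smult tq.submoduleE[OF J.ideal_submodule])
  show ?thesis
    by (intro operadic_ideal.intro)
      (auto simp: sub source.pcomp_closed hom_pcomp J.ideal_left J.ideal_right hom_closed)
qed

end

section \<open>Ideals generated by relations\<close>

context ns_operad
begin

text \<open>The largest ideal: its presence ensures that the intersection defining a generated ideal
  is taken over a nonempty family.\<close>

lemma carrier_operadic_ideal: "operadic_ideal K P (op_carrier P)"
  by (intro operadic_ideal.intro) (auto simp: module.carrier_is_submodule[OF arity_module] pcomp_closed)

lemma generated_ideal_operadic_ideal:
  assumes "\<And>n. R n \<subseteq> op_carrier P n"
  shows "operadic_ideal K P (generated_ideal K P R)"
proof -
  let ?F = "\<lambda>I. operadic_ideal K P I \<and> (\<forall>m. R m \<subseteq> I m)"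
  have mem: "x \<in> generated_ideal K P R n \<longleftrightarrow> (\<forall>I. ?F I \<longrightarrow> x \<in> I n)" for x n
    unfolding generated_ideal_def by blast
  \<comment> \<open>Since the operad itself is among the intersected ideals, the intersection lies
    in the carrier. The remaining closure properties hold in each ideal separately.\<close>
  have F: "?F (op_carrier P)"
    using carrier_operadic_ideal assms by blast
  have "submodule (generated_ideal K P R n) K (arity_space P n)" for n
  proof -
    interpret module K "arity_space P n" by (rule arity_module)
    note E = submoduleE[OF operadic_ideal.ideal_submodule]
    show ?thesis
    proof (rule submoduleI)
      have "\<zero>\<^bsub>arity_space P n\<^esub> \<in> I n" if "?F I" for I
        using subgroup.one_closed[OF submodule.axioms(1)[OF operadic_ideal.ideal_submodule[of K P I n]]]
          that by simp
      then show "\<zero>\<^bsub>arity_space P n\<^esub> \<in> generated_ideal K P R n"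
        by (simp add: mem)
    qed (use F E in \<open>auto simp: mem\<close>)
  qed
  moreover have "pcomp P m n i x y \<in> generated_ideal K P R (m + n - 1)"
    if "x \<in> generated_ideal K P R m" "y \<in> op_carrier P n" "1 \<le> i" "i \<le> m" for m n i x y
    using that operadic_ideal.ideal_left[of K P] by (simp add: mem)
  moreover have "pcomp P m n i x y \<in> generated_ideal K P R (m + n - 1)"
    if "x \<in> op_carrier P m" "y \<in> generated_ideal K P R n" "1 \<le> i" "i \<le> m" for m n i x y
    using that operadic_ideal.ideal_right[of K P] by (simp add: mem)
  ultimately show ?thesis
    by (rule operadic_ideal.intro)
qed

end

lemma generated_ideal_superset: "R n \<subseteq> generated_ideal K P R n"
  unfolding generated_ideal_def by blast

lemma generated_ideal_least:
  assumes "operadic_ideal K P I" "\<And>m. R m \<subseteq> I m"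
  shows "generated_ideal K P R n \<subseteq> I n"
  using assms unfolding generated_ideal_def by blast

section \<open>Morphisms induced on quotients\<close>

text \<open>The union over representatives matches the coset operations. Restricting to the carrier
  makes the map extensional, so that it can be unique as a function.\<close>

definition quotient_map ::
  "('k, 'x) ns_operad \<Rightarrow> (nat \<Rightarrow> 'x set) \<Rightarrow> ('k, 'y) ns_operad \<Rightarrow> (nat \<Rightarrow> 'y set)
    \<Rightarrow> (nat \<Rightarrow> 'x \<Rightarrow> 'y) \<Rightarrow> nat \<Rightarrow> 'x set \<Rightarrow> 'y set" where
  "quotient_map P I Q J F n =
     (\<lambda>U \<in> op_carrier (quotient_operad P I) n. \<Union>x\<in>U. J n +>\<^bsub>arity_space Q n\<^esub> F n x)"

locale ns_operad_hom_ideals =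
  ns_operad_hom K P Q \<Theta> + source: ns_operad_with_ideal K P I + target: ns_operad_with_ideal K Q J
  for K (structure) and P Q \<Theta> I J +
  assumes hom_ideal: "x \<in> I n \<Longrightarrow> \<Theta> n x \<in> J n"
begin

text \<open>Representatives differ by an element of \<open>I\<close>, and by
  \<open>hom_ideal\<close> their images differ by an element of \<open>J\<close>.\<close>

lemma quotient_map_coset:
  assumes "x \<in> op_carrier P n"
  shows "quotient_map P I Q J \<Theta> n (source.coset n x) = target.coset n (\<Theta> n x)"
proof -
  have "target.coset n (\<Theta> n x') = target.coset n (\<Theta> n x)" if "x' \<in> source.coset n x" for x'
    using that
  proof (rule source.M.coset_memE)
    fix h assume h: "h \<in> I n" "x' = h \<oplus>\<^bsub>arity_space P n\<^esub> x"
    moreover from h have "h \<in> op_carrier P n"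
      using source.M.a_subset by blast
    ultimately show ?thesis
      using assms by (simp add: hom_add target.M.coset_absorb hom_ideal hom_closed)
  qed
  then have "(\<Union>x'\<in>source.coset n x. target.coset n (\<Theta> n x')) = target.coset n (\<Theta> n x)"
    by (intro UN_eq_const[OF source.M.a_rcos_self[OF assms]])
  then show ?thesis
    using assms by (simp add: quotient_map_def source.M.coset_in_rcosets)
qed

lemma quotient_map_hom:
  "ns_operad_hom K (quotient_operad P I) (quotient_operad Q J) (quotient_map P I Q J \<Theta>)"
proof -
  interpret P: ns_operad K "quotient_operad P I"
    by (rule source.quotient_ns_operad)
  interpret Q: ns_operad K "quotient_operad Q J"
    by (rule target.quotient_ns_operad)
  show ?thesis
  proof unfold_locales
    show "quotient_map P I Q J \<Theta> 1 (op_unit (quotient_operad P I)) = op_unit (quotient_operad Q J)"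
      using source.unit_closed by (simp add: quotient_map_coset hom_unit)
  qed (auto elim!: source.M.rcosetsE
      simp: quotient_map_coset hom_closed hom_add hom_smult hom_pcomp
        source.M.a_rcos_sum target.M.a_rcos_sum source.M.quotient_smult target.M.quotient_smult
        source.quotient_pcomp target.quotient_pcomp source.pcomp_closed target.M.coset_in_rcosets)
qed

end

section \<open>The free operad\<close>

lemma scale_add_right: "scale c (v + w) = scale c v + scale c w"
  by (rule poly_mapping_eqI) (simp add: lookup_add distrib_left)

lemma scale_add_left: "scale (c + d) v = scale c v + scale d v"
  by (rule poly_mapping_eqI) (simp add: lookup_add distrib_right)

lemma scale_scale: "scale c (scale d v) = scale (c * d) v"
  by (rule poly_mapping_eqI) (simp add: mult.assoc)

lemma scale_zero [simp]: "scale c 0 = 0" "scale 0 v = 0"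
  by (rule poly_mapping_eqI, simp)+

lemma scale_single [simp]: "scale c (Poly_Mapping.single b a) = Poly_Mapping.single b (c * a)"
  by (rule poly_mapping_eqI) (simp add: lookup_single when_def)

lemma scale_sum: "scale c (sum f S) = (\<Sum>s\<in>S. scale c (f s))"
  by (induction S rule: infinite_finite_induct) (simp_all add: scale_add_right)

lemma keys_scale_subset: "Poly_Mapping.keys (scale c v) \<subseteq> Poly_Mapping.keys v"
  by (auto simp: in_keys_iff)

text \<open>The linear map with value \<open>f s\<close> at the basis vector \<open>s\<close>. Both
  \<open>free_pcomp\<close> (as a nested extension) and \<open>relabel\<close> have this form, so
  linearity is proved once for all.\<close>

definition lin_ext :: "('a \<Rightarrow> 'b \<Rightarrow>\<^sub>0 'k::field) \<Rightarrow> ('a \<Rightarrow>\<^sub>0 'k) \<Rightarrow> 'b \<Rightarrow>\<^sub>0 'k" where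
  "lin_ext f v = (\<Sum>s \<in> Poly_Mapping.keys v. scale (Poly_Mapping.lookup v s) (f s))"

text \<open>Additional indices contribute zero. This gives \<open>v\<close>, \<open>w\<close> and
  \<open>v + w\<close> a common index set, although cancellation may shrink the keys of the
  sum.\<close>

lemma lin_ext_superset:
  assumes "finite S" "Poly_Mapping.keys v \<subseteq> S"
  shows "lin_ext f v = (\<Sum>s \<in> S. scale (Poly_Mapping.lookup v s) (f s))"
  unfolding lin_ext_def by (rule sum.mono_neutral_left) (use assms in \<open>auto simp: in_keys_iff\<close>)

lemma lin_ext_zero [simp]: "lin_ext f 0 = 0"
  by (simp add: lin_ext_def)

lemma lin_ext_single [simp]: "lin_ext f (Poly_Mapping.single s a) = scale a (f s)"
  by (subst lin_ext_superset[of "{s}"]) auto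

lemma lin_ext_add: "lin_ext f (v + w) = lin_ext f v + lin_ext f w"
  by (subst (1 2 3) lin_ext_superset[of "Poly_Mapping.keys v \<union> Poly_Mapping.keys w"])
    (auto simp: Poly_Mapping.keys_add lookup_add scale_add_left sum.distrib)

lemma lin_ext_scale: "lin_ext f (scale c v) = scale c (lin_ext f v)"
  by (subst (1 2) lin_ext_superset[of "Poly_Mapping.keys v"])
    (auto simp: keys_scale_subset scale_sum scale_scale)

lemma lin_ext_fun_add: "lin_ext (\<lambda>s. f s + g s) v = lin_ext f v + lin_ext g v"
  by (simp add: lin_ext_def scale_add_right sum.distrib)

lemma lin_ext_fun_scale: "lin_ext (\<lambda>s. scale c (f s)) v = scale c (lin_ext f v)"
  by (simp add: lin_ext_def scale_sum scale_scale mult.commute)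

lemma lin_ext_fun_zero [simp]: "lin_ext (\<lambda>s. 0) v = 0"
  by (simp add: lin_ext_def)

lemma lin_ext_basis: "lin_ext (\<lambda>s. Poly_Mapping.single s 1) v = v"
  by (rule poly_mapping_eqI)
    (simp add: lin_ext_def lookup_sum lookup_single when_def in_keys_iff)

lemma free_space_simps [simp]:
  "carrier (free_space n) = {v. \<forall>t \<in> Poly_Mapping.keys v. leaves t = n}"
  "zero (free_space n) = 0"
  "add (free_space n) = (+)"
  "module.smult (free_space n) = scale"
  by (simp_all add: free_space_def)

text \<open>The trees with \<open>n\<close> leaves span the space, since a vector is the finite sum
  of its basis components. Multilinear identities are thereby reduced to identities of
  trees.\<close>

lemma free_space_induct [consumes 1, case_names zero basis add scale]:
  assumes "v \<in> carrier (free_space n)"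
    and zero: "P 0"
    and basis: "\<And>t. leaves t = n \<Longrightarrow> P (Poly_Mapping.single t 1)"
    and add: "\<And>v w. \<lbrakk>v \<in> carrier (free_space n); w \<in> carrier (free_space n); P v; P w\<rbrakk> \<Longrightarrow> P (v + w)"
    and scale: "\<And>c v. \<lbrakk>v \<in> carrier (free_space n); P v\<rbrakk> \<Longrightarrow> P (scale c v)"
  shows "P v"
proof -
  \<comment> \<open>Membership of the partial sums is carried through the induction because the
    premise \<open>add\<close> asks for it.\<close>
  have step: "(\<Sum>t\<in>S. Poly_Mapping.single t (Poly_Mapping.lookup v t)) \<in> carrier (free_space n)
      \<and> P (\<Sum>t\<in>S. Poly_Mapping.single t (Poly_Mapping.lookup v t))"
    if "finite S" "S \<subseteq> Poly_Mapping.keys v" for S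
    using that
  proof (induction S)
    case (insert t S)
    let ?w = "\<Sum>t\<in>S. Poly_Mapping.single t (Poly_Mapping.lookup v t)"
    let ?u = "Poly_Mapping.single t (Poly_Mapping.lookup v t)"
    have t: "leaves t = n"
      using insert.prems assms(1) by auto
    then have u: "?u \<in> carrier (free_space n)"
      by auto
    have "P (scale (Poly_Mapping.lookup v t) (Poly_Mapping.single t 1))"
      using t by (intro scale basis) auto
    then have "P ?u"
      by simp
    moreover have "?u + ?w \<in> carrier (free_space n)"
      using insert u Poly_Mapping.keys_add[of ?u ?w] by auto
    ultimately show ?case
      using insert u add[of ?u ?w] by simp
  qed (simp add: zero)
  have "v = (\<Sum>t\<in>Poly_Mapping.keys v. Poly_Mapping.single t (Poly_Mapping.lookup v t))"
    using lin_ext_basis[of v] by (simp add: lin_ext_def)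
  then show ?thesis
    using step[of "Poly_Mapping.keys v"] by simp
qed

text \<open>Composition is the bilinear extension of grafting; \<open>free_pcomp_simps\<close>
  follows from the linearity of \<open>lin_ext\<close>.\<close>

lemma free_pcomp_lin_ext:
  "free_pcomp i v w = lin_ext (\<lambda>s. lin_ext (\<lambda>t. Poly_Mapping.single (graft s i t) 1) w) v"
  by (simp add: free_pcomp_def lin_ext_def scale_sum)

lemma free_pcomp_simps:
  "free_pcomp i (v + v') w = free_pcomp i v w + free_pcomp i v' w"
  "free_pcomp i v (w + w') = free_pcomp i v w + free_pcomp i v w'"
  "free_pcomp i (scale c v) w = scale c (free_pcomp i v w)"
  "free_pcomp i v (scale c w) = scale c (free_pcomp i v w)"
  "free_pcomp i 0 w = 0"
  "free_pcomp i v 0 = 0"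
  "free_pcomp i (Poly_Mapping.single s 1) (Poly_Mapping.single t 1) = Poly_Mapping.single (graft s i t) 1"
  by (simp_all add: free_pcomp_lin_ext lin_ext_add lin_ext_scale lin_ext_fun_add lin_ext_fun_scale)

lemma free_operad_simps [simp]:
  "arity_space free_operad = free_space"
  "op_unit free_operad = Poly_Mapping.single Leaf 1"
  "pcomp free_operad m n i = free_pcomp i"
  by (simp_all add: free_operad_def)

section \<open>Grafting of trees\<close>

lemma leaves_pos: "1 \<le> leaves t"
  by (induction t) auto

text \<open>Grafting uses up one leaf of \<open>s\<close> and brings in those of \<open>t\<close>.
  Positivity of leaf numbers keeps the truncated subtraction exact.\<close>

lemma leaves_graft: "\<lbrakk>1 \<le> i; i \<le> leaves s\<rbrakk> \<Longrightarrow> leaves (graft s i t) = leaves s + leaves t - 1"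
proof (induction s arbitrary: i)
  case (Node g l r)
  then show ?case
    using Node.IH(1)[of i] Node.IH(2)[of "i - leaves l"] leaves_pos[of t] leaves_pos[of l] leaves_pos[of r]
    by auto
qed simp

lemma graft_Leaf: "\<lbrakk>1 \<le> i; i \<le> leaves s\<rbrakk> \<Longrightarrow> graft s i Leaf = s"
  by (induction s arbitrary: i) auto

text \<open>Inside \<open>graft s i t\<close> the leaves of \<open>t\<close> occupy the positions
  from \<open>i\<close> on, so the \<open>j\<close>-th of them has number
  \<open>i + j - 1\<close>.\<close>

lemma graft_sequential:
  "\<lbrakk>1 \<le> i; i \<le> leaves s; 1 \<le> j; j \<le> leaves t\<rbrakk>
    \<Longrightarrow> graft (graft s i t) (i + j - 1) u = graft s i (graft t j u)"
proof (induction s arbitrary: i)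
  case (Node g l r)
  then show ?case
  proof (cases "i \<le> leaves l")
    case True
    then show ?thesis
      using Node by (auto simp: leaves_graft)
  next
    case False
    then have "i + j - 1 - leaves l = i - leaves l + j - 1" "\<not> i + j - 1 \<le> leaves l"
      using Node.prems by auto
    with False show ?thesis
      using Node.prems Node.IH(2)[of "i - leaves l"] by simp
  qed
qed simp

text \<open>Replacing leaf \<open>i\<close> by \<open>t\<close> shifts every later leaf by
  \<open>leaves t - 1\<close>, while grafting at the later leaf \<open>j\<close> leaves the number
  \<open>i\<close> unchanged.\<close>

lemma graft_parallel:
  "\<lbrakk>1 \<le> i; i < j; j \<le> leaves s\<rbrakk>
    \<Longrightarrow> graft (graft s i t) (j + leaves t - 1) u = graft (graft s j u) i t"
proof (induction s arbitrary: i j)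
  case (Node g l r)
  \<comment> \<open>Since \<open>i < j\<close>, either both leaves lie in the left subtree, or they
    are separated by the root, or both lie in the right subtree.\<close>
  consider "j \<le> leaves l" | "i \<le> leaves l" "\<not> j \<le> leaves l" | "\<not> i \<le> leaves l"
    by linarith
  then show ?case
  proof cases
    case 1
    then show ?thesis
      using Node.prems Node.IH(1)[of i j] leaves_pos[of u] by (auto simp: leaves_graft)
  next
    case 2
    then have "\<not> j + leaves t - 1 \<le> leaves l + leaves t - 1"
      "j + leaves t - 1 - (leaves l + leaves t - 1) = j - leaves l"
      using Node.prems leaves_pos[of t] by auto
    with 2 show ?thesis
      using Node.prems by (simp add: leaves_graft)
  next
    case 3
    then have "\<not> j + leaves t - 1 \<le> leaves l" "\<not> j \<le> leaves l"
      "j + leaves t - 1 - leaves l = j - leaves l + leaves t - 1"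
      using Node.prems leaves_pos[of t] by auto
    with 3 show ?thesis
      using Node.prems Node.IH(2)[of "i - leaves l" "j - leaves l"] by simp
  qed
qed simp

section \<open>The operad axioms for the free operad\<close>

lemma free_carrier_closed:
  assumes "v \<in> carrier (free_space n)"
  shows "w \<in> carrier (free_space n) \<Longrightarrow> v + w \<in> carrier (free_space n)"
    and "scale c v \<in> carrier (free_space n)"
    and "- v \<in> carrier (free_space n)"
  using assms Poly_Mapping.keys_add[of v w] keys_scale_subset[of c v] by (auto simp: in_keys_iff)

lemma ring_of_type_algebra_simps [simp]:
  "carrier ring_of_type_algebra = UNIV"
  "add ring_of_type_algebra = (+)"
  "monoid.mult ring_of_type_algebra = (*)"
  "one ring_of_type_algebra = 1"
  "zero ring_of_type_algebra = 0"
  by (simp_all add: ring_of_type_algebra_def)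

lemma free_space_module: "module ring_of_type_algebra (free_space n :: ('k::field, _) module)"
proof (rule moduleI)
  show "cring (ring_of_type_algebra :: 'k ring)"
    by (rule cring_from_type_algebra)
  show "abelian_group (free_space n :: ('k, _) module)"
  proof (rule abelian_groupI)
    fix v w :: "'b bintree \<Rightarrow>\<^sub>0 'k"
    assume v: "v \<in> carrier (free_space n)"
    show "v \<oplus>\<^bsub>free_space n\<^esub> w \<in> carrier (free_space n)" if "w \<in> carrier (free_space n)"
      using free_carrier_closed(1)[OF v that] by simp
    from v show "\<exists>w\<in>carrier (free_space n). w \<oplus>\<^bsub>free_space n\<^esub> v = \<zero>\<^bsub>free_space n\<^esub>"
      using free_carrier_closed(3)[of v n] by (intro bexI[of _ "- v"]) simp_all
  qed (auto simp: add.assoc add.commute)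
qed (auto simp: scale_add_left scale_add_right scale_scale dest: subsetD[OF keys_scale_subset])

text \<open>By bilinearity it suffices to compose two trees, where \<open>leaves_graft\<close> gives
  the arity.\<close>

lemma free_pcomp_closed:
  assumes "v \<in> carrier (free_space m)" "w \<in> carrier (free_space n)" "1 \<le> i" "i \<le> m"
  shows "free_pcomp i v w \<in> carrier (free_space (m + n - 1))"
  using assms(1)
proof (induction rule: free_space_induct)
  case (basis s)
  show ?case
    using assms(2)
  proof (induction rule: free_space_induct)
    case (basis t)
    then show ?case
      using assms \<open>leaves s = m\<close> by (simp add: free_pcomp_simps leaves_graft)
  qed (simp_all only: free_pcomp_simps free_carrier_closed, simp)
qed (simp_all only: free_pcomp_simps free_carrier_closed, simp)

text \<open>Both associativity axioms are trilinear: three nested inductions reduce them to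
  \<open>graft_sequential\<close> and \<open>graft_parallel\<close>.\<close>

lemma free_ns_operad: "ns_operad ring_of_type_algebra (free_operad :: ('k::field, 'g bintree \<Rightarrow>\<^sub>0 'k) ns_operad)"
proof (intro ns_operad.intro ns_operad_axioms.intro)
  show "field (ring_of_type_algebra :: 'k ring)"
    by (rule field_from_type_algebra)
  fix l m n i j and u v w :: "'g bintree \<Rightarrow>\<^sub>0 'k"
  show "module (ring_of_type_algebra :: 'k ring) (arity_space (free_operad :: ('k, 'g bintree \<Rightarrow>\<^sub>0 'k) ns_operad) n)"
    by (simp add: free_space_module)
  show "pcomp free_operad m n i v w \<in> op_carrier free_operad (m + n - 1)"
    if "v \<in> op_carrier free_operad m" "w \<in> op_carrier free_operad n" "1 \<le> i" "i \<le> m"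
    using free_pcomp_closed that by simp
  show "pcomp free_operad 1 n 1 (op_unit free_operad) v = v" if "v \<in> op_carrier free_operad n"
    using that[simplified free_operad_simps]
    by (induction rule: free_space_induct) (simp_all add: free_pcomp_simps)
  show "pcomp free_operad m 1 i v (op_unit free_operad) = v"
    if "v \<in> op_carrier free_operad m" "1 \<le> i" "i \<le> m"
    using that(1)[simplified free_operad_simps] that(2,3)
    by (induction rule: free_space_induct) (simp_all add: free_pcomp_simps graft_Leaf)
  {
    assume u: "u \<in> op_carrier free_operad l" and v: "v \<in> op_carrier free_operad m"
      and w: "w \<in> op_carrier free_operad n"
    note uvw = this[unfolded free_operad_simps]
    show "pcomp free_operad (l + m - 1) n (i + j - 1) (pcomp free_operad l m i u v) w
        = pcomp free_operad l (m + n - 1) i u (pcomp free_operad m n j v w)"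
      if "1 \<le> i" "i \<le> l" "1 \<le> j" "j \<le> m"
      unfolding free_operad_simps using uvw(1)
    proof (induction rule: free_space_induct)
      case (basis s)
      note s = basis
      show ?case
        using uvw(2)
      proof (induction rule: free_space_induct)
        case (basis t)
        note t = basis
        show ?case
          using uvw(3)
        proof (induction rule: free_space_induct)
          case (basis r)
          then show ?case
            using s t that by (simp add: free_pcomp_simps graft_sequential)
        qed (simp_all add: free_pcomp_simps)
      qed (simp_all add: free_pcomp_simps)
    qed (simp_all add: free_pcomp_simps)
    show "pcomp free_operad (l + m - 1) n (j + m - 1) (pcomp free_operad l m i u v) w
        = pcomp free_operad (l + n - 1) m i (pcomp free_operad l n j u w) v"
      if "1 \<le> i" "i < j" "j \<le> l"
      unfolding free_operad_simps using uvw(1)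
    proof (induction rule: free_space_induct)
      case (basis s)
      note s = basis
      show ?case
        using uvw(2)
      proof (induction rule: free_space_induct)
        case (basis t)
        note t = basis
        show ?case
          using uvw(3)
        proof (induction rule: free_space_induct)
          case (basis r)
          then show ?case
            using s t that graft_parallel[of i j s t r] by (simp add: free_pcomp_simps)
        qed (simp_all add: free_pcomp_simps)
      qed (simp_all add: free_pcomp_simps)
    qed (simp_all add: free_pcomp_simps)
  }
qed (simp_all add: free_pcomp_simps)

section \<open>Relabelling of generators\<close>

definition relabel :: "('g \<Rightarrow> 'h) \<Rightarrow> ('g bintree \<Rightarrow>\<^sub>0 'k::field) \<Rightarrow> 'h bintree \<Rightarrow>\<^sub>0 'k" where
  "relabel f = lin_ext (\<lambda>t. Poly_Mapping.single (map_bintree f t) 1)"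

lemma relabel_simps:
  "relabel f (v + w) = relabel f v + relabel f w"
  "relabel f (scale c v) = scale c (relabel f v)"
  "relabel f 0 = 0"
  "relabel f (Poly_Mapping.single t a) = Poly_Mapping.single (map_bintree f t) a"
  by (simp_all add: relabel_def lin_ext_add lin_ext_scale)

lemma leaves_map_bintree [simp]: "leaves (map_bintree f t) = leaves t"
  by (induction t) simp_all

lemma map_bintree_graft: "map_bintree f (graft s i t) = graft (map_bintree f s) i (map_bintree f t)"
  by (induction s arbitrary: i) simp_all

text \<open>Changing decorations preserves the shape of a tree, hence its leaf count, and commutes
  with grafting.\<close>

lemma relabel_hom:
  fixes f :: "'g \<Rightarrow> 'h"
  shows "ns_operad_hom (ring_of_type_algebra :: 'k::field ring) free_operad free_operad (\<lambda>n. relabel f)"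
proof (intro ns_operad_hom.intro ns_operad_hom_axioms.intro free_ns_operad)
  fix m n i and v w :: "'g bintree \<Rightarrow>\<^sub>0 'k"
  assume v: "v \<in> op_carrier free_operad n"
  show "relabel f v \<in> op_carrier free_operad n"
    using v[unfolded free_operad_simps] unfolding free_operad_simps
  proof (induction rule: free_space_induct)
    case (basis t)
    then show ?case
      by (simp add: relabel_simps)
  qed (simp_all only: relabel_simps free_carrier_closed, simp)
next
  fix m n i and v w :: "'g bintree \<Rightarrow>\<^sub>0 'k"
  assume "v \<in> op_carrier free_operad m" and w: "w \<in> op_carrier free_operad n"
  then have "v \<in> carrier (free_space m)"
    by simp
  then show "relabel f (pcomp free_operad m n i v w) = pcomp free_operad m n i (relabel f v) (relabel f w)"
    unfolding free_operad_simps
  proof (induction rule: free_space_induct)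
    case (basis s)
    show ?case
      using w[unfolded free_operad_simps]
      by (induction rule: free_space_induct)
        (simp_all add: relabel_simps free_pcomp_simps map_bintree_graft)
  qed (simp_all add: relabel_simps free_pcomp_simps)
qed (simp_all add: relabel_simps)

section \<open>Uniqueness of morphisms out of the free operad\<close>

lemma free_gen_closed: "free_gen g \<in> carrier (free_space 2)"
  by (simp add: free_gen_def)

text \<open>Induction on trees: a morphism is determined at a tree by its values at the root
  generator and at the two subtrees. Linearity passes from trees to all elements.\<close>

lemma free_operad_hom_unique:
  fixes F G :: "nat \<Rightarrow> ('g bintree \<Rightarrow>\<^sub>0 'k::field) \<Rightarrow> 'x"
  assumes "ns_operad_hom ring_of_type_algebra free_operad Q F"
    and "ns_operad_hom ring_of_type_algebra free_operad Q G"
    and gen: "\<And>g. F 2 (free_gen g) = G 2 (free_gen g)"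
    and "v \<in> op_carrier free_operad n"
  shows "F n v = G n v"
proof -
  interpret F: ns_operad_hom ring_of_type_algebra free_operad Q F by fact
  interpret G: ns_operad_hom ring_of_type_algebra free_operad Q G by fact
  have tree: "F (leaves t) (Poly_Mapping.single t 1) = G (leaves t) (Poly_Mapping.single t 1)" for t
  proof (induction t)
    case Leaf
    then show ?case
      using F.hom_unit G.hom_unit by simp
  next
    case (Node g l r)
    define T :: "'g bintree \<Rightarrow> 'g bintree \<Rightarrow>\<^sub>0 'k" where "T = (\<lambda>t. Poly_Mapping.single t 1)"
    have T: "T t \<in> op_carrier free_operad (leaves t)" for t
      by (simp add: T_def)
    have gen_closed: "free_gen g \<in> op_carrier free_operad 2"
      by (simp only: free_operad_simps free_gen_closed)
    have arity: "2 + leaves r - 1 = 1 + leaves r" "1 + leaves r + leaves l - 1 = leaves l + leaves r"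
      by simp_all
    have inner: "free_pcomp 2 (free_gen g) (T r) \<in> op_carrier free_operad (1 + leaves r)"
      using free_pcomp_closed[OF free_gen_closed T[of r, unfolded free_operad_simps], of 2 g, unfolded arity]
      by simp
    \<comment> \<open>The right subtree is grafted first, because this leaves the first leaf with
      its number 1 for the left subtree.\<close>
    have node: "T (Node g l r) = free_pcomp 1 (free_pcomp 2 (free_gen g) (T r)) (T l)"
      by (simp add: T_def free_gen_def free_pcomp_simps)
    have hom_node: "H (leaves l + leaves r) (T (Node g l r))
      = pcomp Q (1 + leaves r) (leaves l) 1 (pcomp Q 2 (leaves r) 2 (H 2 (free_gen g)) (H (leaves r) (T r)))
          (H (leaves l) (T l))"
      if "ns_operad_hom ring_of_type_algebra free_operad Q H" for H
    proof -
      have "H (1 + leaves r) (free_pcomp 2 (free_gen g) (T r))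
        = pcomp Q 2 (leaves r) 2 (H 2 (free_gen g)) (H (leaves r) (T r))"
        using ns_operad_hom.hom_pcomp[OF that gen_closed T[of r], of 2, unfolded arity] by simp
      then show ?thesis
        using ns_operad_hom.hom_pcomp[OF that inner T[of l], of 1, unfolded arity] by (simp add: node)
    qed
    then show ?case
      using Node hom_node[OF assms(1)] hom_node[OF assms(2)] gen by (simp add: T_def)
  qed
  have "v \<in> carrier (free_space n)"
    using assms(4) by simp
  then show ?thesis
  proof (induction rule: free_space_induct)
    case zero
    then show ?case
      using F.hom_zero G.hom_zero by simp
  next
    case (basis t)
    then show ?case
      using tree by blast
  next
    case (add v w)
    then show ?case
      using F.hom_add[of v n w] G.hom_add[of v n w] by simp
  next
    case (scale c v)
    then show ?case
      using F.hom_smult[of c v n] G.hom_smult[of c v n] by simp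
  qed
qed

section \<open>Presented operads\<close>

lemma free_with_relation_ideal:
  assumes "R \<subseteq> carrier (free_space 3)"
  shows "ns_operad_with_ideal ring_of_type_algebra free_operad (relation_ideal R)"
  unfolding relation_ideal_def
  by (intro ns_operad_with_ideal.intro free_ns_operad
      ns_operad.generated_ideal_operadic_ideal[OF free_ns_operad])
    (use assms in auto)

lemma relation_ideal_superset: "R \<subseteq> relation_ideal R 3"
  using generated_ideal_superset[of "\<lambda>n. if n = 3 then R else {}" 3]
  by (simp add: relation_ideal_def)

text \<open>It is enough to test the relations themselves; that the whole ideal is respected follows
  from minimality.\<close>

lemma presented_operad_hom:
  fixes R :: "('g bintree \<Rightarrow>\<^sub>0 'k::field) set" and S :: "('h bintree \<Rightarrow>\<^sub>0 'k) set"
  assumes R: "R \<subseteq> carrier (free_space 3)" and S: "S \<subseteq> carrier (free_space 3)"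
    and rel: "\<And>r. r \<in> R \<Longrightarrow> relabel f r \<in> relation_ideal S 3"
  defines "\<Theta> \<equiv> quotient_map free_operad (relation_ideal R) free_operad (relation_ideal S) (\<lambda>n. relabel f)"
  shows "ns_operad_hom ring_of_type_algebra (presented_operad R) (presented_operad S) \<Theta>"
    and "\<Theta> 2 (presented_gen R g) = presented_gen S (f g)"
proof -
  interpret I: ns_operad_with_ideal ring_of_type_algebra free_operad "relation_ideal R"
    by (rule free_with_relation_ideal[OF R])
  interpret J: ns_operad_with_ideal ring_of_type_algebra free_operad "relation_ideal S"
    by (rule free_with_relation_ideal[OF S])
  interpret F: ns_operad_hom ring_of_type_algebra free_operad free_operad "\<lambda>n. relabel f"
    by (rule relabel_hom)
  \<comment> \<open>The preimage of the ideal of \<open>S\<close> is an ideal containing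
    \<open>R\<close>, hence it contains the ideal generated by \<open>R\<close>.\<close>
  have "relation_ideal R n \<subseteq> {v \<in> op_carrier free_operad n. relabel f v \<in> relation_ideal S n}" for n
    unfolding relation_ideal_def[of R]
    by (rule generated_ideal_least[OF F.vimage_ideal[OF J.operadic_ideal_axioms]])
      (use R rel in auto)
  then interpret ns_operad_hom_ideals ring_of_type_algebra free_operad free_operad "\<lambda>n. relabel f"
      "relation_ideal R" "relation_ideal S"
    by unfold_locales auto
  show "ns_operad_hom ring_of_type_algebra (presented_operad R) (presented_operad S) \<Theta>"
    unfolding presented_operad_def \<Theta>_def by (rule quotient_map_hom)
  have "relabel f (free_gen g) = (free_gen (f g) :: _ \<Rightarrow>\<^sub>0 'k)"
    by (simp add: free_gen_def relabel_simps)
  then show "\<Theta> 2 (presented_gen R g) = presented_gen S (f g)"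
    using quotient_map_coset[of "free_gen g" 2] free_gen_closed[of g]
    by (simp add: presented_gen_def \<Theta>_def)
qed

text \<open>After composition with the projection, two morphisms out of the quotient become
  morphisms out of the free operad that agree on generators; every element of the quotient is the
  coset of an element there.\<close>

lemma presented_operad_hom_unique:
  fixes R :: "('g bintree \<Rightarrow>\<^sub>0 'k::field) set"
  assumes R: "R \<subseteq> carrier (free_space 3)"
    and F: "ns_operad_hom ring_of_type_algebra (presented_operad R) Q F"
    and G: "ns_operad_hom ring_of_type_algebra (presented_operad R) Q G"
    and gen: "\<And>g. F 2 (presented_gen R g) = G 2 (presented_gen R g)"
    and U: "U \<in> op_carrier (presented_operad R) n"
  shows "F n U = G n U"
proof -
  interpret I: ns_operad_with_ideal ring_of_type_algebra free_operad "relation_ideal R"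
    by (rule free_with_relation_ideal[OF R])
  obtain v where v: "v \<in> op_carrier free_operad n" "U = I.coset n v"
    using U I.M.rcosetsE by (auto simp: presented_operad_def)
  have "F n (I.coset n v) = G n (I.coset n v)"
  proof (rule free_operad_hom_unique[OF _ _ _ v(1)])
    show "ns_operad_hom ring_of_type_algebra free_operad Q (\<lambda>n v. F n (I.coset n v))"
      "ns_operad_hom ring_of_type_algebra free_operad Q (\<lambda>n v. G n (I.coset n v))"
      by (rule ns_operad_hom_comp[OF I.coset_hom], use F G in \<open>simp only: presented_operad_def\<close>)+
    show "F 2 (I.coset 2 (free_gen g)) = G 2 (I.coset 2 (free_gen g))" for g
      using gen[of g] by (simp only: presented_gen_def)
  qed
  with v show ?thesis by simp
qed

section \<open>The two presentations and the morphism between them\<close>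

lemma free_pcomp_gen_closed:
  "free_pcomp 1 (free_gen g) (free_gen h) \<in> carrier (free_space 3)"
  "free_pcomp 2 (free_gen g) (free_gen h) \<in> carrier (free_space 3)"
  using free_pcomp_closed[OF free_gen_closed free_gen_closed, of 1 g h]
    free_pcomp_closed[OF free_gen_closed free_gen_closed, of 2 g h] by simp_all

lemma free_diff_closed:
  assumes "v \<in> carrier (free_space n)" "w \<in> carrier (free_space n)"
  shows "v - w \<in> carrier (free_space n)"
  using free_carrier_closed(1)[OF assms(1) free_carrier_closed(3)[OF assms(2)]] by simp

text \<open>That values on generators define a morphism is expressed as unique existence. The
  morphism axioms do not constrain \<open>\<Theta>\<close> outside the arity spaces;
  \<open>extensional\<close> fixes it there.\<close>

theorem proposition3p14:
  fixes arr tri :: "'w \<Rightarrow> 'w \<Rightarrow> 'w"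
    and \<Phi> :: "(('w \<times> 'w) \<Rightarrow>\<^sub>0 'k::field) \<Rightarrow> (('w \<times> 'w) \<Rightarrow>\<^sub>0 'k)"
  assumes "EAS arr tri"
    and "\<Phi> = linearization arr tri"
  shows "\<exists>!\<Theta>. ns_operad_hom ring_of_type_algebra (As2 arr) (AsPhi \<Phi>) \<Theta>
    \<and> (\<forall>n. \<Theta> n \<in> extensional (op_carrier (As2 arr :: ('k, _) ns_operad) n))
    \<and> (\<forall>\<alpha> \<beta>. \<Theta> 2 (As2_gen arr \<alpha> \<beta>) = AsPhi_gen \<Phi> (tri \<alpha> \<beta>))"
proof -
  interpret EAS arr tri by fact
  define R where "R = (As2_relations arr :: (('w \<times> 'w) bintree \<Rightarrow>\<^sub>0 'k) set)"
  define S where "S = AsPhi_relations \<Phi>"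
  define f where "f = (\<lambda>(\<alpha>, \<beta>). tri \<alpha> \<beta>)"
  have S_eq: "S = {free_pcomp 2 (free_gen \<alpha>) (free_gen \<beta>)
      - free_pcomp 1 (free_gen (arr \<alpha> \<beta>)) (free_gen (tri \<alpha> \<beta>)) | \<alpha> \<beta>. True}"
    by (simp only: S_def assms(2) AsPhi_relations_linearization)
  have R: "R \<subseteq> carrier (free_space 3)"
    unfolding R_def As2_relations_def by (blast intro: free_diff_closed free_pcomp_gen_closed)
  have S: "S \<subseteq> carrier (free_space 3)"
    unfolding S_eq by (blast intro: free_diff_closed free_pcomp_gen_closed)
  interpret J: ns_operad_with_ideal ring_of_type_algebra free_operad "relation_ideal S"
    by (rule free_with_relation_ideal[OF S])
  have rel: "relabel f r \<in> relation_ideal S 3" if "r \<in> R" for r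
  proof -
    obtain \<alpha> \<beta> \<gamma> where r: "r = free_pcomp 1 (free_gen (arr \<alpha> \<beta>, \<gamma>)) (free_gen (\<alpha>, \<beta>))
        - free_pcomp 2 (free_gen (\<alpha>, arr \<beta> \<gamma>)) (free_gen (\<beta>, \<gamma>))"
      using \<open>r \<in> R\<close> by (auto simp: R_def As2_relations_def)
    \<comment> \<open>These are the labels that \<open>f\<close> gives to the
      \<open>\<circ>\<^sub>2\<close> term of \<open>r\<close>, and so they single out the relation
      \<open>?s\<close> of \<open>S\<close> to compare with.\<close>
    let ?a = "tri \<alpha> (arr \<beta> \<gamma>)" and ?b = "tri \<beta> \<gamma>"
    let ?s = "free_pcomp 2 (free_gen ?a) (free_gen ?b)
      - free_pcomp 1 (free_gen (arr ?a ?b)) (free_gen (tri ?a ?b)) :: 'w bintree \<Rightarrow>\<^sub>0 'k"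
    \<comment> \<open>The difference is rewritten with a sum and the scalar minus one, the
      operations through which \<open>relabel\<close> is known to pass.\<close>
    have "r = free_pcomp 1 (free_gen (arr \<alpha> \<beta>, \<gamma>)) (free_gen (\<alpha>, \<beta>))
        + scale (- 1) (free_pcomp 2 (free_gen (\<alpha>, arr \<beta> \<gamma>)) (free_gen (\<beta>, \<gamma>)))"
      unfolding r by (rule poly_mapping_eqI) (simp add: lookup_add lookup_minus)
    \<comment> \<open>The \<open>\<circ>\<^sub>1\<close> term acquires the labels
      \<open>tri (arr \<alpha> \<beta>) \<gamma>\<close> and \<open>tri \<alpha> \<beta>\<close>,
      which are \<open>arr ?a ?b\<close> by \<open>arr_tri\<close> and \<open>tri ?a ?b\<close> by
      \<open>tri_tri\<close>. The order of the two terms is opposite to that in \<open>?s\<close>,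
      whence the sign.\<close>
    then have "relabel f r = scale (- 1) ?s"
      by (intro poly_mapping_eqI)
        (simp add: f_def free_gen_def free_pcomp_simps relabel_simps arr_tri tri_tri
          lookup_add lookup_minus lookup_single when_def)
    moreover have "?s \<in> relation_ideal S 3"
      by (rule subsetD[OF relation_ideal_superset]) (auto simp only: S_eq)
    ultimately show ?thesis
      using submodule.smult_closed[OF J.ideal_submodule[of 3], of "- 1" ?s] by simp
  qed
  define \<Theta> where "\<Theta> = quotient_map free_operad (relation_ideal R) free_operad (relation_ideal S)
    (\<lambda>n. relabel f)"
  have ops: "As2 arr = presented_operad R" "AsPhi \<Phi> = presented_operad S"
    by (simp_all add: As2_def AsPhi_def R_def S_def)
  have gens: "As2_gen arr \<alpha> \<beta> = presented_gen R (\<alpha>, \<beta>)" "AsPhi_gen \<Phi> (tri \<alpha> \<beta>) = presented_gen S (f (\<alpha>, \<beta>))"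
    for \<alpha> \<beta>
    by (simp_all add: As2_gen_def AsPhi_gen_def R_def S_def f_def)
  have hom: "ns_operad_hom ring_of_type_algebra (presented_operad R) (presented_operad S) \<Theta>"
    unfolding \<Theta>_def by (rule presented_operad_hom(1)[OF R S rel])
  have gen: "\<Theta> 2 (presented_gen R g) = presented_gen S (f g)" for g
    unfolding \<Theta>_def by (rule presented_operad_hom(2)[OF R S rel])
  have ext: "\<Theta> n \<in> extensional (op_carrier (presented_operad R) n)" for n
    unfolding \<Theta>_def quotient_map_def presented_operad_def by (rule restrict_extensional)
  show ?thesis
    unfolding ops gens
  proof (rule ex1I[of _ \<Theta>], intro conjI allI hom gen ext)
    fix \<Theta>'
    assume \<Theta>': "ns_operad_hom ring_of_type_algebra (presented_operad R) (presented_operad S) \<Theta>' \<and>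
      (\<forall>n. \<Theta>' n \<in> extensional (op_carrier (presented_operad R) n)) \<and>
      (\<forall>\<alpha> \<beta>. \<Theta>' 2 (presented_gen R (\<alpha>, \<beta>)) = presented_gen S (f (\<alpha>, \<beta>)))"
    have gen': "\<Theta>' 2 (presented_gen R g) = \<Theta> 2 (presented_gen R g)" for g
      unfolding gen by (cases g) (simp only: \<Theta>')
    \<comment> \<open>Both families are extensional, so equality need only be checked on the arity
      spaces, where agreement on generators decides.\<close>
    show "\<Theta>' = \<Theta>"
    proof (intro HOL.ext[of \<Theta>' \<Theta>] extensionalityI[OF _ ext])
      show "\<Theta>' n \<in> extensional (op_carrier (presented_operad R) n)" for n
        by (simp only: \<Theta>')
      show "\<Theta>' n U = \<Theta> n U" if "U \<in> op_carrier (presented_operad R) n" for n U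
        using presented_operad_hom_unique[OF R conjunct1[OF \<Theta>'] hom gen' that] .
    qed
  qed
qed

end
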